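(* Let $\bm{X}=(X_1,\ldots,X_d)$ be a random vector on $\mathbb{R}^d$, let $\bm{X}_1,\bm{X}_2,\ldots$ be independent copies of $\bm{X}$, let $r_n>0$, $r_n\to\infty$, and let $N_n=\{\bm{X}_1/r_n,\ldots,\bm{X}_n/r_n\}$ be the scaled $n$-point sample cloud. Assume that $N_n$ converges in probability, as $n\to\infty$, onto a limit set $G=\{\bm{x}\in\mathbb{R}^d: g(\bm{x})\le1\}$ for a gauge function $g$. Let $I_m\subset I=\{1,\ldots,d\}$ be an index set with $|I_m|=m$, and let $\widetilde{\bm{X}}=(X_i)_{i\in I_m}$ be the corresponding $m$-dimensional marginal of $\bm{X}$. Then sample clouds from $\widetilde{\bm{X}}$, with the same scaling $r_n$, also converge in probability onto a limit set, and this limit set is $$\widetilde G=P_m(G)=\{\bm{y}\in\mathbb{R}^m:\tilde g(\bm{y})\le1\},$$ where $P_m$ is the projection map onto the coordinates of $\widetilde{\bm{X}}$ and $$\tilde g(\bm{y})=\min_{\{x_i:\ i\in I\setminus I_m\}} g(\bm{x}),\qquad \bm{x}=(x_1,\ldots,x_d),\quad \bm{y}=(x_i)_{i\in I_m}.$$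
   Context: A sequence of random non-empty compact sets $N_n\subset\mathbb{R}^d$ converges in probability onto a deterministic non-empty compact set $G$ (the limit set) if $d_H(N_n,G)\to0$ in probability, where $d_H$ is the Hausdorff distance. The gauge function of a compact star-shaped set $G$ (i.e. $\bm{x}\in G$ implies $t\bm{x}\in G$ for all $t\in[0,1]$) is $g(\bm{x})=\inf\{t\ge0:\bm{x}\in tG\}$. It satisfies $g(t\bm{x})=tg(\bm{x})$ for $t>0$, and $G=\{\bm{x}: g(\bm{x})\le1\}$. *)

theory Defs
  imports "HOL-Probability.Probability"
begin

text \<open>The suprema are the usual ones whenever both sets are non-empty and bounded; this is
  the only case in which the function is used below.\<close>

definition hausdorff_dist :: "'a::metric_space set \<Rightarrow> 'a set \<Rightarrow> real" where
  "hausdorff_dist A B = max (SUP x\<in>A. infdist x B) (SUP y\<in>B. infdist y A)"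

text \<open>Measurability is expressed through hitting events of open sets.  For compact subsets of
  a Euclidean space this is the Borel \<open>\<sigma>\<close>-algebra of the Hausdorff metric.\<close>

definition random_compact_set :: "'w measure \<Rightarrow> ('w \<Rightarrow> 'a::metric_space set) \<Rightarrow> bool" where
  "random_compact_set M N \<longleftrightarrow>
     (\<forall>\<omega>\<in>space M. compact (N \<omega>) \<and> N \<omega> \<noteq> {}) \<and>
     (\<forall>U. open U \<longrightarrow> {\<omega>\<in>space M. N \<omega> \<inter> U \<noteq> {}} \<in> sets M)"

text \<open>Sequences start at index 1.\<close>

definition converges_in_prob_onto ::
    "'w measure \<Rightarrow> (nat \<Rightarrow> 'w \<Rightarrow> 'a::metric_space set) \<Rightarrow> 'a set \<Rightarrow> bool" where
  "converges_in_prob_onto M N G \<longleftrightarrow>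
     compact G \<and> G \<noteq> {} \<and> (\<forall>n\<ge>1. random_compact_set M (N n)) \<and>
     (\<forall>\<epsilon>>0. (\<lambda>n. measure M {\<omega>\<in>space M. hausdorff_dist (N n \<omega>) G > \<epsilon>}) \<longlonglongrightarrow> 0)"

text \<open>The copies may live on a probability space \<open>M'\<close> different from the space \<open>M\<close>
  carrying \<open>X\<close>.\<close>

definition independent_copies ::
    "'v measure \<Rightarrow> (nat \<Rightarrow> 'v \<Rightarrow> 'a::topological_space) \<Rightarrow> 'w measure \<Rightarrow> ('w \<Rightarrow> 'a) \<Rightarrow> bool" where
  "independent_copies M' Xs M X \<longleftrightarrow>
     prob_space M' \<and>
     prob_space.indep_vars M' (\<lambda>_. borel) Xs {1..} \<and>
     (\<forall>i\<ge>1. distr M' borel (Xs i) = distr M borel X)"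

definition sample_cloud ::
    "(nat \<Rightarrow> real) \<Rightarrow> (nat \<Rightarrow> 'w \<Rightarrow> 'a::real_vector) \<Rightarrow> nat \<Rightarrow> 'w \<Rightarrow> 'a set" where
  "sample_cloud r Xs n \<omega> = (\<lambda>i. Xs i \<omega> /\<^sub>R r n) ` {1..n}"

definition star_shaped :: "'a::real_vector set \<Rightarrow> bool" where
  "star_shaped G \<longleftrightarrow> (\<forall>x\<in>G. \<forall>t\<in>{0..1}. t *\<^sub>R x \<in> G)"

text \<open>Extended real values are needed because \<open>G\<close> may miss a whole ray: the infimum
  of the empty set is then \<open>\<infinity>\<close>.\<close>

definition gauge_of :: "'a::real_vector set \<Rightarrow> 'a \<Rightarrow> ereal" where
  "gauge_of G x = Inf {ereal t | t. t \<ge> 0 \<and> x \<in> (*\<^sub>R) t ` G}"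

definition gauge_function :: "('a::real_normed_vector \<Rightarrow> ereal) \<Rightarrow> bool" where
  "gauge_function g \<longleftrightarrow> (\<exists>G. compact G \<and> G \<noteq> {} \<and> star_shaped G \<and> g = gauge_of G)"

text \<open>The map \<open>e\<close> enumerates the selected coordinates by the index type of the
  smaller space.\<close>

definition coord_proj :: "('m \<Rightarrow> 'n) \<Rightarrow> real^'n \<Rightarrow> real^'m" where
  "coord_proj e x = (\<chi> j. x $ e j)"

text \<open>The free variables of the minimisation are the coordinates outside the range of \<open>e\<close>.
  The infimum is a minimum if \<open>g\<close> is a gauge function, but not for arbitrary \<open>g\<close>.\<close>

definition marginal_gauge :: "('m \<Rightarrow> 'n) \<Rightarrow> (real^'n \<Rightarrow> ereal) \<Rightarrow> real^'m \<Rightarrow> ereal" where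
  "marginal_gauge e g y = (INF x\<in>{x. coord_proj e x = y}. g x)"

end

theory Submission
  imports Defs
begin

text \<open>Coordinate projections are 1-Lipschitz, hence do not increase Hausdorff distances, so the
  projected cloud of \<open>X\<close> converges onto \<open>coord_proj e ` G\<close>.  The law of the Hausdorff distance
  of an \<open>n\<close>-point cloud to a compact set depends only on the law of a single point, which
  transfers the convergence to independent copies on any other space.  The minimum in the
  marginal gauge is attained because the scalars \<open>t \<ge> 0\<close> for which \<open>t *\<^sub>R K\<close> meets a closed set
  form a closed set when \<open>K\<close> is compact.\<close>

section \<open>Hausdorff distance and its behaviour under non-expansive maps\<close>

lemma bdd_above_infdist:
  assumes "bounded A" "B \<noteq> {}"
  shows "bdd_above ((\<lambda>x. infdist x B) ` A)"
proof -
  obtain b where b: "b \<in> B" using assms(2) by blast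
  obtain e where e: "\<And>x. x \<in> A \<Longrightarrow> dist b x \<le> e"
    using assms(1) unfolding bounded_any_center[where a = b] by blast
  have "infdist x B \<le> e" if "x \<in> A" for x
    using infdist_le[OF b, of x] e[OF that] by (simp add: dist_commute)
  then show ?thesis by (intro bdd_aboveI2)
qed

text \<open>With a strict bound each supremum becomes a plain existence statement, and no attainment
  has to be discussed. Boundedness and non-emptiness make the real suprema genuine. The contraction
  and the measurability arguments both start from this form.\<close>

lemma less_hausdorff_dist_iff:
  assumes "bounded A" "A \<noteq> {}" "bounded B" "B \<noteq> {}"
  shows "\<epsilon> < hausdorff_dist A B \<longleftrightarrow> (\<exists>x\<in>A. \<epsilon> < infdist x B) \<or> (\<exists>y\<in>B. \<epsilon> < infdist y A)"
  unfolding hausdorff_dist_def less_max_iff_disj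
  using less_cSUP_iff[OF assms(2) bdd_above_infdist[OF assms(1,4)]]
    less_cSUP_iff[OF assms(4) bdd_above_infdist[OF assms(3,2)]] by simp

lemma infdist_image_le:
  assumes "\<And>x y. dist (f x) (f y) \<le> dist x y" "B \<noteq> {}"
  shows "infdist (f x) (f ` B) \<le> infdist x B"
proof -
  have "infdist (f x) (f ` B) \<le> dist x b" if "b \<in> B" for b
    using infdist_le[of "f b" "f ` B" "f x"] that assms(1)[of x b] by fastforce
  then show ?thesis
    unfolding infdist_notempty[OF assms(2)] by (intro cINF_greatest assms(2))
qed

lemma less_infdist_finite_iff:
  assumes "finite A" "A \<noteq> {}"
  shows "\<epsilon> < infdist y A \<longleftrightarrow> (\<forall>a\<in>A. \<epsilon> < dist y a)"
  using assms by (simp add: infdist_notempty cInf_eq_Min)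

lemma bounded_image_nonexpansive:
  assumes "\<And>x y. dist (f x) (f y) \<le> dist x y" "bounded A"
  shows "bounded (f ` A)"
proof -
  obtain a e where "\<And>x. x \<in> A \<Longrightarrow> dist a x \<le> e"
    using assms(2) unfolding bounded_def by blast
  then have "\<forall>y\<in>f ` A. dist (f a) y \<le> e"
    using assms(1)[of a] by (force intro: order_trans)
  then show ?thesis unfolding bounded_def by blast
qed

text \<open>A point of one image that is far from the other image comes from a point at least as far
  from the other set, by \<open>infdist_image_le\<close>. Phrased as an implication between strict
  bounds, this gives an inclusion of events directly.\<close>

lemma less_hausdorff_dist_image:
  assumes "\<And>x y. dist (f x) (f y) \<le> dist x y"
    and "bounded A" "A \<noteq> {}" "bounded B" "B \<noteq> {}"
    and "\<epsilon> < hausdorff_dist (f ` A) (f ` B)"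
  shows "\<epsilon> < hausdorff_dist A B"
proof -
  have "(\<exists>x\<in>A. \<epsilon> < infdist (f x) (f ` B)) \<or> (\<exists>y\<in>B. \<epsilon> < infdist (f y) (f ` A))"
    using assms(2-6) bounded_image_nonexpansive[of f, OF assms(1)]
    by (subst (asm) less_hausdorff_dist_iff) auto
  then show ?thesis
    unfolding less_hausdorff_dist_iff[OF assms(2-5)]
    using less_le_trans[OF _ infdist_image_le[of f, OF assms(1,3)]]
      less_le_trans[OF _ infdist_image_le[of f, OF assms(1,5)]] by blast
qed

section \<open>Measurability of distance events for finite random clouds\<close>

lemma sets_hausdorff_dist_finite_greater:
  fixes f :: "'i \<Rightarrow> 'w \<Rightarrow> 'a::{metric_space, second_countable_topology}"
  assumes f: "\<And>i. i \<in> I \<Longrightarrow> f i \<in> borel_measurable M"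
    and I: "finite I" "I \<noteq> {}" and K: "compact K" "K \<noteq> {}"
  shows "{\<omega>\<in>space M. \<epsilon> < hausdorff_dist ((\<lambda>i. f i \<omega>) ` I) K} \<in> sets M"
proof -
  \<comment> \<open>The supremum over \<open>K\<close> is uncountable; a countable dense part
    \<open>D\<close> takes its place, so that the event becomes a countable union.\<close>
  obtain D where D: "countable D" "D \<subseteq> K" "K \<subseteq> closure D"
    using separable by blast
  have eq: "\<epsilon> < hausdorff_dist ((\<lambda>i. f i \<omega>) ` I) K \<longleftrightarrow>
      (\<exists>i\<in>I. \<epsilon> < infdist (f i \<omega>) K) \<or> (\<exists>y\<in>D. \<forall>i\<in>I. \<epsilon> < dist y (f i \<omega>))" for \<omega>
  proof -
    let ?V = "{y. \<epsilon> < infdist y ((\<lambda>i. f i \<omega>) ` I)}"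
    \<comment> \<open>The points farther than \<open>\<epsilon>\<close> from the cloud form an open
      set. If it meets \<open>K\<close>, which lies in the closure of \<open>D\<close>, it already
      meets \<open>D\<close>.\<close>
    have "open ?V"
      by (intro open_Collect_less continuous_intros)
    then have "(\<exists>y\<in>K. y \<in> ?V) \<longleftrightarrow> (\<exists>y\<in>D. y \<in> ?V)"
      using D(2,3) open_Int_closure_eq_empty[of ?V D] by blast
    then show ?thesis
      using I K by (subst less_hausdorff_dist_iff)
        (auto simp: less_infdist_finite_iff compact_imp_bounded finite_imp_bounded)
  qed
  have "{\<omega>\<in>space M. \<epsilon> < hausdorff_dist ((\<lambda>i. f i \<omega>) ` I) K} =
      (\<Union>i\<in>I. {\<omega>\<in>space M. \<epsilon> < infdist (f i \<omega>) K}) \<union>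
      (\<Union>y\<in>D. {\<omega>\<in>space M. \<forall>i\<in>I. \<epsilon> < dist y (f i \<omega>)})"
    unfolding eq by blast
  moreover have "{\<omega>\<in>space M. \<epsilon> < infdist (f i \<omega>) K} \<in> sets M" if "i \<in> I" for i
  proof -
    have "(\<lambda>\<omega>. infdist (f i \<omega>) K) \<in> borel_measurable M"
      by (intro borel_measurable_continuous_on[OF _ f[OF that]] continuous_intros)
    then show ?thesis by measurable
  qed
  moreover have "{\<omega>\<in>space M. \<forall>i\<in>I. \<epsilon> < dist y (f i \<omega>)} \<in> sets M" for y
  proof (intro sets.sets_Collect_finite_All' I)
    fix i assume "i \<in> I"
    then have "(\<lambda>\<omega>. dist y (f i \<omega>)) \<in> borel_measurable M"
      by (intro borel_measurable_continuous_on[OF _ f] continuous_intros)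
    then show "{\<omega>\<in>space M. \<epsilon> < dist y (f i \<omega>)} \<in> sets M" by measurable
  qed
  ultimately show ?thesis
    using I(1) D(1) by (auto intro!: sets.Un sets.countable_UN'' countable_finite)
qed

section \<open>Independent copies and the laws of their sample clouds\<close>

lemma independent_copies_measurable:
  assumes "independent_copies M' Xs M X" "i \<ge> 1"
  shows "Xs i \<in> borel_measurable M'"
  using assms unfolding independent_copies_def
  by (auto simp: prob_space.indep_vars_def)

lemma independent_copies_compose:
  assumes "independent_copies M' Xs M X" "X \<in> borel_measurable M" "f \<in> borel_measurable borel"
  shows "independent_copies M' (\<lambda>i \<omega>. f (Xs i \<omega>)) M (\<lambda>\<omega>. f (X \<omega>))"
proof -
  interpret prob_space M' using assms(1) by (simp add: independent_copies_def)
  have "indep_vars (\<lambda>_. borel) (\<lambda>i. f \<circ> Xs i) {1..}"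
    using assms by (intro indep_vars_compose) (auto simp: independent_copies_def)
  moreover have "distr M' borel (\<lambda>\<omega>. f (Xs i \<omega>)) = distr M borel (\<lambda>\<omega>. f (X \<omega>))" if "i \<ge> 1" for i
  proof -
    have "distr (distr M' borel (Xs i)) borel f = distr (distr M borel X) borel f"
      using assms(1) that by (simp add: independent_copies_def)
    then show ?thesis
      using assms(2,3) independent_copies_measurable[OF assms(1) that]
      by (simp add: distr_distr o_def)
  qed
  ultimately show ?thesis
    by (simp add: independent_copies_def prob_space_axioms o_def)
qed

text \<open>Independence makes the joint law a product, and equal marginals make it a power of the
  law of \<open>X\<close>; the right-hand side involves neither \<open>M'\<close> nor
  \<open>Xs\<close>. The product criterion asks for a non-empty index set, hence
  \<open>n \<ge> 1\<close>.\<close>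

lemma independent_copies_distr_eq:
  fixes Xs :: "nat \<Rightarrow> 'v \<Rightarrow> 'a::topological_space"
  assumes "independent_copies M' Xs M X" "n \<ge> 1"
  shows "distr M' (Pi\<^sub>M {1..n} (\<lambda>_. borel)) (\<lambda>\<omega>. \<lambda>i\<in>{1..n}. Xs i \<omega>) =
    Pi\<^sub>M {1..n} (\<lambda>_. distr M borel X)"
proof -
  interpret prob_space M' using assms(1) by (simp add: independent_copies_def)
  have "indep_vars (\<lambda>_. borel) Xs {1..n}"
    using assms(1) by (auto simp: independent_copies_def intro: indep_vars_subset)
  then have "distr M' (Pi\<^sub>M {1..n} (\<lambda>_. borel)) (\<lambda>\<omega>. \<lambda>i\<in>{1..n}. Xs i \<omega>) =
      Pi\<^sub>M {1..n} (\<lambda>i. distr M' borel (Xs i))"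
    using assms(2) independent_copies_measurable[OF assms(1)]
    by (subst (asm) indep_vars_iff_distr_eq_PiM') auto
  also have "\<dots> = Pi\<^sub>M {1..n} (\<lambda>_. distr M borel X)"
    using assms(1) by (intro PiM_cong) (auto simp: independent_copies_def)
  finally show ?thesis .
qed

lemma sets_hausdorff_dist_sample_cloud:
  fixes Xs :: "nat \<Rightarrow> 'v \<Rightarrow> 'a::{real_normed_vector, second_countable_topology}"
  assumes "\<And>i. i \<ge> 1 \<Longrightarrow> Xs i \<in> borel_measurable M'"
    and "compact K" "K \<noteq> {}" "n \<ge> 1"
  shows "{\<omega>\<in>space M'. \<epsilon> < hausdorff_dist (sample_cloud r Xs n \<omega>) K} \<in> sets M'"
  unfolding sample_cloud_def using assms
  by (intro sets_hausdorff_dist_finite_greater borel_measurable_scaleR) auto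

text \<open>The distance event is the preimage of one fixed measurable set of
  \<open>n\<close>-tuples under the map to the first \<open>n\<close> points, and this tuple has the
  same law on both spaces. As the spaces may differ, probabilities rather than events are
  compared.\<close>

lemma independent_copies_hausdorff_dist_eq:
  fixes X :: "'w \<Rightarrow> 'a::{real_normed_vector, second_countable_topology}"
  assumes Xs: "independent_copies M\<^sub>1 Xs M X" and Ys: "independent_copies M\<^sub>2 Ys M X"
    and K: "compact K" "K \<noteq> {}" and n: "n \<ge> 1"
  shows "measure M\<^sub>1 {\<omega>\<in>space M\<^sub>1. \<epsilon> < hausdorff_dist (sample_cloud r Xs n \<omega>) K} =
    measure M\<^sub>2 {\<omega>\<in>space M\<^sub>2. \<epsilon> < hausdorff_dist (sample_cloud r Ys n \<omega>) K}"
proof -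
  let ?P = "Pi\<^sub>M {1..n} (\<lambda>_. borel :: 'a measure)"
  let ?S = "{z\<in>space ?P. \<epsilon> < hausdorff_dist ((\<lambda>i. z i /\<^sub>R r n) ` {1..n}) K}"
  have S: "?S \<in> sets ?P"
    using n K by (intro sets_hausdorff_dist_finite_greater borel_measurable_scaleR) auto
  \<comment> \<open>The type of points of \<open>N\<close> is left open, so that the claim applies
    to both spaces.\<close>
  have law: "measure N {\<omega>\<in>space N. \<epsilon> < hausdorff_dist (sample_cloud r Zs n \<omega>) K} =
      measure (Pi\<^sub>M {1..n} (\<lambda>_. distr M borel X)) ?S"
    if Zs: "independent_copies N Zs M X" for N :: "'z measure" and Zs
  proof -
    let ?h = "\<lambda>\<omega>. \<lambda>i\<in>{1..n}. Zs i \<omega>"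
    have "?h \<in> measurable N ?P"
      using independent_copies_measurable[OF Zs] by (intro measurable_restrict) auto
    then have "measure (distr N ?P ?h) ?S = measure N (?h -` ?S \<inter> space N)"
      using S by (rule measure_distr)
    \<comment> \<open>The restricted tuple is \<open>undefined\<close> outside
      \<open>{1..n}\<close>, but the cloud reads only indices inside.\<close>
    moreover have "(\<lambda>i. ?h \<omega> i /\<^sub>R r n) ` {1..n} = sample_cloud r Zs n \<omega>" for \<omega>
      unfolding sample_cloud_def by (intro image_cong) auto
    then have "?h -` ?S \<inter> space N =
        {\<omega>\<in>space N. \<epsilon> < hausdorff_dist (sample_cloud r Zs n \<omega>) K}"
      by (auto simp: space_PiM simp del: restrict_apply)
    ultimately show ?thesis
      unfolding independent_copies_distr_eq[OF Zs n] by simp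
  qed
  show ?thesis using law[OF Xs] law[OF Ys] by simp
qed

lemma random_compact_set_sample_cloud:
  fixes Xs :: "nat \<Rightarrow> 'v \<Rightarrow> 'a::{real_normed_vector, second_countable_topology}"
  assumes "\<And>i. i \<ge> 1 \<Longrightarrow> Xs i \<in> borel_measurable M'" "n \<ge> 1"
  shows "random_compact_set M' (sample_cloud r Xs n)"
  unfolding random_compact_set_def
proof (intro conjI ballI allI impI)
  fix U :: "'a set" assume U: "open U"
  have "{\<omega>\<in>space M'. sample_cloud r Xs n \<omega> \<inter> U \<noteq> {}} =
      (\<Union>i\<in>{1..n}. (\<lambda>\<omega>. Xs i \<omega> /\<^sub>R r n) -` U \<inter> space M')"
    by (auto simp: sample_cloud_def)
  also have "\<dots> \<in> sets M'"
    using assms U by (intro sets.finite_UN measurable_sets[of _ _ borel] borel_measurable_scaleR) auto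
  finally show "{\<omega>\<in>space M'. sample_cloud r Xs n \<omega> \<inter> U \<noteq> {}} \<in> sets M'" .
qed (use assms(2) in \<open>auto simp: sample_cloud_def intro: finite_imp_compact\<close>)

text \<open>Equality of laws replaces \<open>Ys\<close> by the images of \<open>Xs\<close>, which
  live on the same space as the original clouds. There the distances compare pointwise, so one
  exceedance event contains the other.\<close>

lemma converges_in_prob_onto_nonexpansive_image:
  fixes X :: "'w \<Rightarrow> 'a::{real_normed_vector, second_countable_topology}"
    and f :: "'a \<Rightarrow> 'b::{real_normed_vector, second_countable_topology}"
  assumes X: "X \<in> borel_measurable M" and Xs: "independent_copies M\<^sub>1 Xs M X"
    and Ys: "independent_copies M\<^sub>2 Ys M (\<lambda>\<omega>. f (X \<omega>))"
    and f: "linear f" "\<And>x y. dist (f x) (f y) \<le> dist x y"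
    and conv: "converges_in_prob_onto M\<^sub>1 (sample_cloud r Xs) G"
  shows "converges_in_prob_onto M\<^sub>2 (sample_cloud r Ys) (f ` G)"
proof -
  interpret prob_space M\<^sub>1 using Xs by (simp add: independent_copies_def)
  let ?Zs = "\<lambda>i \<omega>. f (Xs i \<omega>)"
  have G: "compact G" "G \<noteq> {}"
    using conv by (simp_all add: converges_in_prob_onto_def)
  have cont: "continuous_on S f" for S
    unfolding continuous_on_iff using f(2) by (metis le_less_trans)
  then have fG: "compact (f ` G)" "f ` G \<noteq> {}"
    using G by (auto intro: compact_continuous_image)
  have Zs: "independent_copies M\<^sub>1 ?Zs M (\<lambda>\<omega>. f (X \<omega>))"
    by (intro independent_copies_compose[OF Xs X] borel_measurable_continuous_onI cont)
  note meas = independent_copies_measurable[OF Xs]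
  have "(\<lambda>n. measure M\<^sub>2 {\<omega>\<in>space M\<^sub>2. \<epsilon> < hausdorff_dist (sample_cloud r Ys n \<omega>) (f ` G)})
      \<longlonglongrightarrow> 0" if "\<epsilon> > 0" for \<epsilon>
  proof (rule tendsto_sandwich[OF _ _ tendsto_const])
    show "(\<lambda>n. prob {\<omega>\<in>space M\<^sub>1. \<epsilon> < hausdorff_dist (sample_cloud r Xs n \<omega>) G}) \<longlonglongrightarrow> 0"
      using conv that by (simp add: converges_in_prob_onto_def)
    show "\<forall>\<^sub>F n in sequentially.
        measure M\<^sub>2 {\<omega>\<in>space M\<^sub>2. \<epsilon> < hausdorff_dist (sample_cloud r Ys n \<omega>) (f ` G)}
        \<le> prob {\<omega>\<in>space M\<^sub>1. \<epsilon> < hausdorff_dist (sample_cloud r Xs n \<omega>) G}"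
    \<comment> \<open>At index 0 the cloud is empty; the comparison starts at 1, which is enough for
      the limit.\<close>
    proof (rule eventually_sequentiallyI[of 1])
      fix n :: nat assume n: "n \<ge> 1"
      have "measure M\<^sub>2 {\<omega>\<in>space M\<^sub>2. \<epsilon> < hausdorff_dist (sample_cloud r Ys n \<omega>) (f ` G)} =
          prob {\<omega>\<in>space M\<^sub>1. \<epsilon> < hausdorff_dist (sample_cloud r ?Zs n \<omega>) (f ` G)}"
        by (rule independent_copies_hausdorff_dist_eq[OF Ys Zs fG n])
      also have "\<dots> \<le> prob {\<omega>\<in>space M\<^sub>1. \<epsilon> < hausdorff_dist (sample_cloud r Xs n \<omega>) G}"
      proof (rule finite_measure_mono)
        \<comment> \<open>Linearity lets \<open>f\<close> commute with the division by
          \<open>r n\<close>, so the cloud of images is the image of the cloud.\<close>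
        have "sample_cloud r ?Zs n \<omega> = f ` sample_cloud r Xs n \<omega>" for \<omega>
          by (simp add: sample_cloud_def image_image linear_cmul[OF f(1)])
        moreover have "bounded (sample_cloud r Xs n \<omega>)" "sample_cloud r Xs n \<omega> \<noteq> {}" for \<omega>
          using n by (auto simp: sample_cloud_def intro: finite_imp_bounded)
        ultimately show "{\<omega>\<in>space M\<^sub>1. \<epsilon> < hausdorff_dist (sample_cloud r ?Zs n \<omega>) (f ` G)}
            \<subseteq> {\<omega>\<in>space M\<^sub>1. \<epsilon> < hausdorff_dist (sample_cloud r Xs n \<omega>) G}"
          using less_hausdorff_dist_image[of f, OF f(2) _ _ compact_imp_bounded[OF G(1)] G(2)]
          by auto
      qed (rule sets_hausdorff_dist_sample_cloud[OF meas G n])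
      finally show "measure M\<^sub>2 {\<omega>\<in>space M\<^sub>2. \<epsilon> < hausdorff_dist (sample_cloud r Ys n \<omega>) (f ` G)}
        \<le> prob {\<omega>\<in>space M\<^sub>1. \<epsilon> < hausdorff_dist (sample_cloud r Xs n \<omega>) G}" .
    qed
  qed simp
  then show ?thesis
    unfolding converges_in_prob_onto_def
    using fG random_compact_set_sample_cloud[of Ys, OF independent_copies_measurable[OF Ys]] by simp
qed

section \<open>Attainment of the minimum of a gauge over a closed set\<close>

lemma closed_scalings_meeting:
  fixes C K :: "'a::real_normed_vector set"
  assumes "compact K" "closed C"
  shows "closed {t. t \<ge> 0 \<and> (\<exists>z\<in>K. t *\<^sub>R z \<in> C)}"
  unfolding closed_sequential_limits
proof (intro allI impI)
  fix u :: "nat \<Rightarrow> real" and v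
  assume *: "(\<forall>n. u n \<in> {t. t \<ge> 0 \<and> (\<exists>z\<in>K. t *\<^sub>R z \<in> C)}) \<and> u \<longlonglongrightarrow> v"
  then obtain z where z: "\<And>n. z n \<in> K" "\<And>n. u n *\<^sub>R z n \<in> C" by simp metis
  \<comment> \<open>Compactness of \<open>K\<close> makes a subsequence of the witnesses converge.
    The products then converge too, and closedness of \<open>C\<close> keeps their limit in
    \<open>C\<close>.\<close>
  obtain l s where l: "l \<in> K" "strict_mono s" "(z \<circ> s) \<longlonglongrightarrow> l"
    using assms(1) z(1) unfolding compact_def by blast
  have lim: "(\<lambda>n. (u \<circ> s) n *\<^sub>R (z \<circ> s) n) \<longlonglongrightarrow> v *\<^sub>R l"
    using * l by (intro tendsto_scaleR LIMSEQ_subseq_LIMSEQ[of u] l(3)) auto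
  have "v *\<^sub>R l \<in> C"
    using z(2) by (intro closed_sequentially[OF assms(2) _ lim]) simp
  moreover have "v \<ge> 0" using * by (intro LIMSEQ_le_const) auto
  ultimately show "v \<in> {t. t \<ge> 0 \<and> (\<exists>z\<in>K. t *\<^sub>R z \<in> C)}" using l(1) by blast
qed

lemma gauge_of_le:
  assumes "t \<ge> 0" "z \<in> K"
  shows "gauge_of K (t *\<^sub>R z) \<le> ereal t"
  unfolding gauge_of_def using assms by (intro Inf_lower) blast

text \<open>Minimising over \<open>x\<close> in \<open>C\<close> and over the scalings of
  \<open>K\<close> that contain \<open>x\<close> amounts to one minimisation over the
  \<open>t \<ge> 0\<close> for which the scaled \<open>K\<close> meets \<open>C\<close>. These
  scalars form a closed set bounded below, so it is either empty or has a least element.\<close>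

lemma INF_gauge_of_cases:
  fixes C K :: "'a::real_normed_vector set"
  assumes "compact K" "closed C"
  obtains (infinite) "(INF x\<in>C. gauge_of K x) = \<infinity>"
    | (attained) t z where "t \<ge> 0" "z \<in> K" "t *\<^sub>R z \<in> C" "(INF x\<in>C. gauge_of K x) = ereal t"
proof (cases "{t. t \<ge> 0 \<and> (\<exists>z\<in>K. t *\<^sub>R z \<in> C)} = {}")
  case True
  \<comment> \<open>No scaling of \<open>K\<close> reaches \<open>x\<close>, so the gauge is an
    infimum over the empty set.\<close>
  then have "gauge_of K x = \<infinity>" if "x \<in> C" for x
    unfolding gauge_of_def using that by (auto simp: top_ereal_def[symmetric] intro!: Inf_eqI)
  then have "(INF x\<in>C. gauge_of K x) = \<infinity>"
    by (auto simp: top_ereal_def[symmetric] intro!: INF_eqI)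
  then show ?thesis by (rule infinite)
next
  case False
  let ?T = "{t. t \<ge> 0 \<and> (\<exists>z\<in>K. t *\<^sub>R z \<in> C)}"
  have bdd: "bdd_below ?T" by (auto intro: bdd_belowI)
  have "Inf ?T \<in> ?T"
    by (rule closed_contains_Inf[OF False bdd closed_scalings_meeting[OF assms]])
  then obtain z where z: "Inf ?T \<ge> 0" "z \<in> K" "Inf ?T *\<^sub>R z \<in> C" by blast
  have "(INF x\<in>C. gauge_of K x) = ereal (Inf ?T)"
  proof (rule antisym)
    show "(INF x\<in>C. gauge_of K x) \<le> ereal (Inf ?T)"
      using gauge_of_le[OF z(1,2)] z(3) by (rule INF_lower2[rotated])
    show "ereal (Inf ?T) \<le> (INF x\<in>C. gauge_of K x)"
      unfolding gauge_of_def using bdd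
      by (intro INF_greatest Inf_greatest) (auto intro!: cInf_lower)
  qed
  then show ?thesis using z by (intro attained)
qed

section \<open>Coordinate projections and the marginal gauge\<close>

lemma linear_coord_proj: "linear (coord_proj e)"
  by (rule linearI) (simp_all add: coord_proj_def vec_eq_iff)

text \<open>Since \<open>e\<close> is injective, no coordinate is counted twice, and the squared
  norm of the projection is a partial sum of that of \<open>x\<close>.\<close>

lemma norm_coord_proj_le:
  fixes e :: "'m::finite \<Rightarrow> 'n::finite"
  assumes "inj e"
  shows "norm (coord_proj e x) \<le> norm x"
proof -
  have "(\<Sum>j\<in>UNIV. (x $ e j)\<^sup>2) = (\<Sum>i\<in>range e. (x $ i)\<^sup>2)"
    using assms by (simp add: sum.reindex)
  also have "\<dots> \<le> (\<Sum>i\<in>UNIV. (x $ i)\<^sup>2)"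
    by (intro sum_mono2) auto
  finally show ?thesis
    by (simp add: norm_vec_def L2_set_def coord_proj_def)
qed

lemma dist_coord_proj_le:
  fixes e :: "'m::finite \<Rightarrow> 'n::finite"
  assumes "inj e"
  shows "dist (coord_proj e x) (coord_proj e y) \<le> dist x y"
  using norm_coord_proj_le[OF assms, of "x - y"]
  by (simp add: dist_norm linear_diff[OF linear_coord_proj])

lemma surj_coord_proj:
  assumes "inj e"
  shows "surj (coord_proj e)"
proof (rule surjI)
  \<comment> \<open>Coordinates outside the range of \<open>e\<close> receive arbitrary entries of
    \<open>y\<close>, which the projection never reads.\<close>
  show "coord_proj e (\<chi> i. y $ inv e i) = y" for y
    using assms by (simp add: coord_proj_def vec_eq_iff)
qed

lemma closed_coord_proj_fibre:
  fixes e :: "'m::finite \<Rightarrow> 'n::finite"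
  shows "closed {x. coord_proj e x = y}"
  by (intro closed_Collect_eq continuous_intros linear_continuous_on)
    (simp add: linear_coord_proj flip: linear_conv_bounded_linear)

text \<open>The marginal gauge is an infimum over a fibre of the projection, and that fibre is
  closed.\<close>

lemma marginal_gauge_attained:
  fixes e :: "'m::finite \<Rightarrow> 'n::finite"
  assumes "inj e" "compact K"
  shows "\<exists>x. coord_proj e x = y \<and> gauge_of K x = marginal_gauge e (gauge_of K) y"
  using assms(2) closed_coord_proj_fibre[of e y]
proof (cases rule: INF_gauge_of_cases)
  case infinite
  \<comment> \<open>Here every point of the fibre is a minimiser; surjectivity guarantees that there
    is one.\<close>
  obtain x where x: "coord_proj e x = y" using surj_coord_proj[OF assms(1)] by (metis surjD)
  then have "marginal_gauge e (gauge_of K) y \<le> gauge_of K x"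
    unfolding marginal_gauge_def by (intro INF_lower) simp
  then show ?thesis using x infinite by (auto simp: marginal_gauge_def)
next
  case (attained t z)
  then have "marginal_gauge e (gauge_of K) y \<le> gauge_of K (t *\<^sub>R z)"
    unfolding marginal_gauge_def by (intro INF_lower) simp
  moreover have "gauge_of K (t *\<^sub>R z) \<le> marginal_gauge e (gauge_of K) y"
    using gauge_of_le[OF attained(1,2)] attained(4) by (simp add: marginal_gauge_def)
  ultimately show ?thesis using attained(3) by (intro exI[of _ "t *\<^sub>R z"]) auto
qed

theorem proposition4:
  fixes M :: "'w measure"
    and X :: "'w \<Rightarrow> real^'n"
    and Xs :: "nat \<Rightarrow> 'w \<Rightarrow> real^'n"
    and r :: "nat \<Rightarrow> real"
    and g :: "real^'n \<Rightarrow> ereal"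
    and G :: "(real^'n) set"
    and I\<^sub>m :: "'n set"
    and e :: "'m::finite \<Rightarrow> 'n"
  assumes "prob_space M"
    and "X \<in> borel_measurable M"
    and "independent_copies M Xs M X"
    and "\<And>n. n \<ge> 1 \<Longrightarrow> r n > 0"
    and "filterlim r at_top sequentially"
    and "gauge_function g"
    and "G = {x. g x \<le> 1}"
    and "converges_in_prob_onto M (sample_cloud r Xs) G"
    and "bij_betw e UNIV I\<^sub>m"
  shows "(\<forall>(M' :: 'v measure) Ys.
            independent_copies M' Ys M (\<lambda>\<omega>. coord_proj e (X \<omega>)) \<longrightarrow>
            converges_in_prob_onto M' (sample_cloud r Ys) (coord_proj e ` G))
       \<and> coord_proj e ` G = {y. marginal_gauge e g y \<le> 1}
       \<and> (\<forall>y. \<exists>x. coord_proj e x = y \<and> g x = marginal_gauge e g y)"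
proof -
  obtain K where K: "compact K" "star_shaped K" "g = gauge_of K"
    using assms(6) unfolding gauge_function_def by blast
  have e: "inj e" using assms(9) by (rule bij_betw_imp_inj_on)
  have attained: "\<exists>x. coord_proj e x = y \<and> g x = marginal_gauge e g y" for y
    unfolding K(3) by (rule marginal_gauge_attained[OF e K(1)])
  moreover have "coord_proj e ` G = {y. marginal_gauge e g y \<le> 1}"
  proof (intro set_eqI iffI)
    fix y assume "y \<in> coord_proj e ` G"
    then show "y \<in> {y. marginal_gauge e g y \<le> 1}"
      unfolding assms(7) marginal_gauge_def by (auto intro: INF_lower2)
  next
    \<comment> \<open>An infimum equal to 1 need not by itself put a point of the fibre into
      \<open>G\<close>; a minimiser over the fibre does lie in \<open>G\<close>.\<close>
    fix y assume "y \<in> {y. marginal_gauge e g y \<le> 1}"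
    then show "y \<in> coord_proj e ` G"
      unfolding assms(7) using attained[of y] by force
  qed
  \<comment> \<open>The given copies live on \<open>M\<close> itself, which serves both as the space
    of \<open>X\<close> and as the space of \<open>Xs\<close>; only \<open>M'\<close> may be a
    different one.\<close>
  moreover have "converges_in_prob_onto M' (sample_cloud r Ys) (coord_proj e ` G)"
    if "independent_copies M' Ys M (\<lambda>\<omega>. coord_proj e (X \<omega>))" for M' :: "'v measure" and Ys
    by (rule converges_in_prob_onto_nonexpansive_image[OF assms(2,3) that linear_coord_proj
          dist_coord_proj_le[OF e] assms(8)])
  ultimately show ?thesis by blast
qed

end
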